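(* Let $\mathcal{G}=(\mathcal{V},\mathcal{E})$ be a colored graph with underlying graph $G=(V,E)$, let $\mathcal{M}$ be a partition of $V$, and consider a sample $y^1,\dots,y^n$ from a multivariate Gaussian $\mathcal{N}_{|V|}(\mu,\Sigma)$ distribution with $\mu\in\Omega(\mathcal{M})$ and $K=\Sigma^{-1}\in\mathcal{S}^{+}(\mathcal{V},\mathcal{E})$, both unknown. Let $\hat\mu$ be the maximum likelihood estimator and $\mu^{*}$ the least-squares estimator of $\mu$ in $\Omega(\mathcal{M})$. Then $$\hat{\mu}=\mu^{*}\quad\Longleftrightarrow\quad \mathcal{M}\le\mathcal{V}\ \text{ and }\ (\mathcal{M},\mathcal{E})\text{ is vertex regular.}$$ The same conclusion holds if $\mathcal{S}^{+}(\mathcal{V},\mathcal{E})$ is replaced by $\mathcal{R}^{+}(\mathcal{V},\mathcal{E})$.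
   Context: Colored graphs: $G=(V,E)$ is a finite simple undirected graph. A vertex coloring is a partition $\mathcal{V}$ of $V$ (its elements are the vertex color classes), an edge coloring is a partition $\mathcal{E}$ of $E$ (its elements are the edge color classes), and $\mathcal{G}=(\mathcal{V},\mathcal{E})$ denotes the colored graph. Model sets: $\mathcal{S}^{+}(G)$ is the set of symmetric positive definite real matrices $K=(k_{\alpha\beta})_{\alpha,\beta\in V}$ with $k_{\alpha\beta}=0$ whenever $\alpha\neq\beta$ and $\{\alpha,\beta\}\notin E$. $\mathcal{S}^{+}(\mathcal{V},\mathcal{E})$ is the set of $K\in\mathcal{S}^{+}(G)$ such that $k_{\alpha\alpha}=k_{\beta\beta}$ whenever $\alpha,\beta$ are in the same class of $\mathcal{V}$, and $k_{\alpha\beta}=k_{\gamma\delta}$ whenever the edges $\{\alpha,\beta\},\{\gamma,\delta\}$ are in the same class of $\mathcal{E}$. $\mathcal{R}^{+}(\mathcal{V},\mathcal{E})$ is the set of $K\in\mathcal{S}^{+}(G)$ such that $k_{\alpha\alpha}=k_{\beta\beta}$ whenever $\alpha,\beta$ are in the same class of $\mathcal{V}$, and the partial correlations $\rho_{\alpha\beta|V\setminus\{\alpha,\beta\}}=-k_{\alpha\beta}/\sqrt{k_{\alpha\alpha}k_{\beta\beta}}$ agree for any two edges $\{\alpha,\beta\}$ in the same class of $\mathcal{E}$. Mean space: for a partition $\mathcal{M}$ of $V$, $\Omega(\mathcal{M})=\{x\in\mathbb{R}^V: x_\alpha=x_\beta$ whenever $\alpha,\beta$ lie in the same set of $\mathcal{M}\}$.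 Order: $\mathcal{M}\le\mathcal{V}$ means that $\mathcal{M}$ is finer than $\mathcal{V}$, i.e. every set in $\mathcal{V}$ is a union of sets in $\mathcal{M}$. Vertex regularity: for $A\subseteq E$ and $\alpha\in V$, $\operatorname{ne}_A(\alpha)$ is the set of vertices connected to $\alpha$ by an edge in $A$. $(\mathcal{M},\mathcal{E})$ is vertex regular if for every $u\in\mathcal{E}$ the partition $\mathcal{M}$ is equitable with respect to the graph $(V,u)$, i.e. for all $m\in\mathcal{M}$, all $\alpha,\beta\in m$ and all $w\in\mathcal{M}$: $|\operatorname{ne}_u(\alpha)\cap w|=|\operatorname{ne}_u(\beta)\cap w|$. Estimators: for a sample $y^1,\dots,y^n\in\mathbb{R}^V$ ($n\ge1$) of independent observations, the likelihood is $L(\mu,K;y)\propto(\det K)^{n/2}\exp\{-\tfrac12\sum_{i=1}^n(y^i-\mu)^TK(y^i-\mu)\}$. For fixed $K$, $\hat\mu$ is the maximizer of $L(\cdot,K;y)$ over $\mu\in\Omega(\mathcal{M})$; the least-squares estimator $\mu^{*}$ is the minimizer of $\sum_{i=1}^n\|y^i-\mu\|^2$ (Euclidean norm) over $\mu\in\Omega(\mathcal{M})$. The assertion $\hat\mu=\mu^{*}$ in a model means that for every $K$ in the model ($K\in\mathcal{S}^{+}(\mathcal{V},\mathcal{E})$, respectively $K\in\mathcal{R}^{+}(\mathcal{V},\mathcal{E})$) and every sample, the maximizer $\hat\mu$ for that $K$ coincides with $\mu^{*}$. *)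

theory Defs
  imports "HOL-Analysis.Analysis" "HOL-Library.Disjoint_Sets"
begin

text \<open>
  The vertex set is the universe of a finite type \<open>'v\<close>; an undirected edge between
  \<open>\<alpha>\<close> and \<open>\<beta>\<close> is the two-element set \<open>{\<alpha>, \<beta>}\<close>.
\<close>

definition simple_graph :: "'v set set \<Rightarrow> bool" where
  "simple_graph E \<longleftrightarrow> (\<forall>e\<in>E. card e = 2)"

definition colored_graph :: "'v set set \<Rightarrow> 'v set set \<Rightarrow> 'v set set set \<Rightarrow> bool" where
  "colored_graph E \<V> \<E> \<longleftrightarrow> simple_graph E \<and> partition_on UNIV \<V> \<and> partition_on E \<E>"

definition pos_def :: "real^'v^'v \<Rightarrow> bool" where
  "pos_def K \<longleftrightarrow> (\<forall>x. x \<noteq> 0 \<longrightarrow> x \<bullet> (K *v x) > 0)"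

definition S_plus_graph :: "'v set set \<Rightarrow> (real^'v^'v) set" where
  "S_plus_graph E =
     {K. transpose K = K \<and> pos_def K \<and> (\<forall>\<alpha> \<beta>. \<alpha> \<noteq> \<beta> \<and> {\<alpha>, \<beta>} \<notin> E \<longrightarrow> K $ \<alpha> $ \<beta> = 0)}"

definition S_plus :: "'v set set \<Rightarrow> 'v set set \<Rightarrow> 'v set set set \<Rightarrow> (real^'v^'v) set" where
  "S_plus E \<V> \<E> =
     {K \<in> S_plus_graph E.
        (\<forall>v\<in>\<V>. \<forall>\<alpha>\<in>v. \<forall>\<beta>\<in>v. K $ \<alpha> $ \<alpha> = K $ \<beta> $ \<beta>) \<and>
        (\<forall>u\<in>\<E>. \<forall>\<alpha> \<beta> \<gamma> \<delta>. {\<alpha>, \<beta>} \<in> u \<and> {\<gamma>, \<delta>} \<in> u \<longrightarrow> K $ \<alpha> $ \<beta> = K $ \<gamma> $ \<delta>)}"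

definition partial_corr :: "real^'v^'v \<Rightarrow> 'v \<Rightarrow> 'v \<Rightarrow> real" where
  "partial_corr K \<alpha> \<beta> = - (K $ \<alpha> $ \<beta>) / sqrt (K $ \<alpha> $ \<alpha> * K $ \<beta> $ \<beta>)"

definition R_plus :: "'v set set \<Rightarrow> 'v set set \<Rightarrow> 'v set set set \<Rightarrow> (real^'v^'v) set" where
  "R_plus E \<V> \<E> =
     {K \<in> S_plus_graph E.
        (\<forall>v\<in>\<V>. \<forall>\<alpha>\<in>v. \<forall>\<beta>\<in>v. K $ \<alpha> $ \<alpha> = K $ \<beta> $ \<beta>) \<and>
        (\<forall>u\<in>\<E>. \<forall>\<alpha> \<beta> \<gamma> \<delta>. {\<alpha>, \<beta>} \<in> u \<and> {\<gamma>, \<delta>} \<in> u \<longrightarrow>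
            partial_corr K \<alpha> \<beta> = partial_corr K \<gamma> \<delta>)}"

definition mean_space :: "'v set set \<Rightarrow> (real^'v) set" where
  "mean_space \<M> = {x. \<forall>m\<in>\<M>. \<forall>\<alpha>\<in>m. \<forall>\<beta>\<in>m. x $ \<alpha> = x $ \<beta>}"

definition finer :: "'v set set \<Rightarrow> 'v set set \<Rightarrow> bool" where
  "finer \<M> \<V> \<longleftrightarrow> (\<forall>v\<in>\<V>. \<exists>S. S \<subseteq> \<M> \<and> v = \<Union>S)"

text \<open>On partitions of a common set this is the library's refinement relation.\<close>

lemma finer_iff_refines:
  assumes M: "partition_on A \<M>" and V: "partition_on A \<V>"
  shows "finer \<M> \<V> \<longleftrightarrow> refines A \<M> \<V>"
proof
  assume f: "finer \<M> \<V>"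
  have "\<exists>v\<in>\<V>. m \<subseteq> v" if m: "m \<in> \<M>" for m
  proof -
    have "m \<noteq> {}" using M m by (auto simp: partition_on_def)
    then obtain x where x: "x \<in> m" by auto
    then have "x \<in> \<Union>\<V>" using M V m unfolding partition_on_def by blast
    then obtain v where v: "v \<in> \<V>" "x \<in> v" by blast
    obtain S where S: "S \<subseteq> \<M>" "v = \<Union>S" using f v(1) unfolding finer_def by meson
    obtain m' where m': "m' \<in> S" "x \<in> m'" using v(2) S(2) by blast
    have "disjoint \<M>" using M by (simp add: partition_on_def)
    then have "m' = m" using m m' x S(1) unfolding disjoint_def by blast
    then show ?thesis using m'(1) S(2) v(1) by blast
  qed
  then show "refines A \<M> \<V>" using M V unfolding refines_def by blast
next
  assume r: "refines A \<M> \<V>"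
  show "finer \<M> \<V>"
    unfolding finer_def
  proof
    fix v assume v: "v \<in> \<V>"
    have "v \<subseteq> \<Union>{m \<in> \<M>. m \<subseteq> v}"
    proof
      fix x assume x: "x \<in> v"
      then have "x \<in> \<Union>\<M>" using M V v unfolding partition_on_def by blast
      then obtain m where m: "m \<in> \<M>" "x \<in> m" by blast
      then obtain v' where v': "v' \<in> \<V>" "m \<subseteq> v'" using r unfolding refines_def by meson
      have "disjoint \<V>" using V by (simp add: partition_on_def)
      then have "v' = v" using v v' x m(2) unfolding disjoint_def by blast
      then show "x \<in> \<Union>{m \<in> \<M>. m \<subseteq> v}" using m v' by blast
    qed
    then have "v = \<Union>{m \<in> \<M>. m \<subseteq> v}" by (intro equalityI) blast+
    moreover have "{m \<in> \<M>. m \<subseteq> v} \<subseteq> \<M>" by (rule Collect_restrict)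
    ultimately show "\<exists>S. S \<subseteq> \<M> \<and> v = \<Union>S" by (intro exI conjI)
  qed
qed

definition ne :: "'v set set \<Rightarrow> 'v \<Rightarrow> 'v set" where
  "ne A \<alpha> = {\<beta>. {\<alpha>, \<beta>} \<in> A}"

definition equitable :: "'v set set \<Rightarrow> 'v set set \<Rightarrow> bool" where
  "equitable \<M> A \<longleftrightarrow>
     (\<forall>m\<in>\<M>. \<forall>\<alpha>\<in>m. \<forall>\<beta>\<in>m. \<forall>w\<in>\<M>. card (ne A \<alpha> \<inter> w) = card (ne A \<beta> \<inter> w))"

definition vertex_regular :: "'v set set \<Rightarrow> 'v set set set \<Rightarrow> bool" where
  "vertex_regular \<M> \<E> \<longleftrightarrow> (\<forall>u\<in>\<E>. equitable \<M> u)"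

text \<open>
  The normal density with mean \<open>\<mu>\<close> and concentration (inverse covariance) matrix \<open>K\<close>,
  and the likelihood of independent observations \<open>y 0, \<dots>, y (n - 1)\<close>.
\<close>

definition gaussian_density :: "real^'v \<Rightarrow> real^'v^'v \<Rightarrow> real^'v \<Rightarrow> real" where
  "gaussian_density \<mu> K x =
     (2 * pi) powr (- real CARD('v) / 2) * sqrt (det K) * exp (- (1/2) * ((x - \<mu>) \<bullet> (K *v (x - \<mu>))))"

definition likelihood :: "nat \<Rightarrow> (nat \<Rightarrow> real^'v) \<Rightarrow> real^'v^'v \<Rightarrow> real^'v \<Rightarrow> real" where
  "likelihood n y K \<mu> = (\<Prod>i<n. gaussian_density \<mu> K (y i))"

lemma likelihood_eq:
  fixes K :: "real^'v^'v"
  assumes "det K > 0"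
  shows "likelihood n y K \<mu> =
     (2 * pi) powr (- real CARD('v) * real n / 2) *
       (det K powr (real n / 2) * exp (- (1/2) * (\<Sum>i<n. (y i - \<mu>) \<bullet> (K *v (y i - \<mu>)))))"
proof -
  have a: "sqrt (det K) ^ n = det K powr (real n / 2)"
    using assms by (simp add: powr_half_sqrt [symmetric] powr_power)
  have b: "((2 * pi) powr (- real CARD('v) / 2)) ^ n = (2 * pi) powr (- real CARD('v) * real n / 2)"
    by (simp add: powr_power mult.commute)
  have c: "(\<Prod>i<n. exp (- (1/2) * ((y i - \<mu>) \<bullet> (K *v (y i - \<mu>))))) =
      exp (- (1/2) * (\<Sum>i<n. (y i - \<mu>) \<bullet> (K *v (y i - \<mu>))))"
    by (simp only: exp_sum [OF finite_lessThan, symmetric] sum_distrib_left)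
  show ?thesis
    unfolding likelihood_def gaussian_density_def prod.distrib c
    by (simp only: prod_constant card_lessThan a b mult.assoc)
qed

text \<open>
  For positive definite \<open>K\<close> and \<open>n \<ge> 1\<close> both optimizers below exist and are unique, since
  \<open>mean_space \<M>\<close> is a linear subspace and the objective is a strictly convex quadratic (after
  taking the logarithm, for the likelihood). Hence the choice made by \<^const>\<open>arg_max\<close>
  and \<^const>\<open>arg_min\<close> is determined.
\<close>

definition mle :: "'v set set \<Rightarrow> nat \<Rightarrow> (nat \<Rightarrow> real^'v) \<Rightarrow> real^'v^'v \<Rightarrow> real^'v" where
  "mle \<M> n y K = (ARG_MAX (likelihood n y K) \<mu>. \<mu> \<in> mean_space \<M>)"

definition lse :: "'v set set \<Rightarrow> nat \<Rightarrow> (nat \<Rightarrow> real^'v) \<Rightarrow> real^'v" where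
  "lse \<M> n y = (ARG_MIN (\<lambda>\<mu>. \<Sum>i<n. (norm (y i - \<mu>))\<^sup>2) \<mu>. \<mu> \<in> mean_space \<M>)"

end

theory Submission
  imports Defs
begin

text \<open>
  Write \<open>L\<close> for the subspace \<open>mean_space \<M>\<close>. Maximising the likelihood for fixed \<open>K\<close> is
  weighted least squares with weight \<open>K\<close>, so both estimators are characterised by normal
  equations: the residual sum \<open>r\<close> satisfies \<open>r \<bottom> L\<close> for the least-squares estimator and
  \<open>K r \<bottom> L\<close> for the maximum likelihood estimator. They coincide for every sample exactly when
  \<open>K\<close> maps the orthogonal complement of \<open>L\<close> to itself, which for symmetric \<open>K\<close> means that \<open>L\<close>
  is \<open>K\<close>-invariant (\<open>mle_eq_lse_iff_invariant\<close>, Kruskal's criterion). The graph enters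
  only through the question which \<open>K\<close> leave \<open>L\<close> invariant.

  In both models the entries of \<open>K\<close> on the edges of colour \<open>u\<close> have the form
  \<open>a u * s \<alpha> * s \<beta>\<close>: with \<open>s = 1\<close> for equal concentrations, and with
  \<open>s \<alpha> = sqrt (K \<alpha> \<alpha>)\<close> and \<open>a u\<close> minus the common partial correlation in the other model.
  When \<open>\<M>\<close> refines \<open>\<V>\<close>, both \<open>s\<close> and the diagonal of \<open>K\<close> lie in \<open>L\<close>, so
  \<open>K\<close> acts on \<open>L\<close> through multiplications by vectors of \<open>L\<close> and sums over the neighbours in one
  edge colour, and equitability says precisely that the latter preserve \<open>L\<close>
  (\<open>invariant_if_vertex_regular\<close>).

  Conversely, two kinds of test matrices lie in both models. The diagonal matrix with entries
  \<open>1\<close> outside and \<open>2\<close> inside a colour class \<open>v \<in> \<V>\<close> maps the all-one vector to a vector of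
  \<open>L\<close> that recovers \<open>v\<close>, so \<open>v\<close> is a union of sets of \<open>\<M>\<close>. A large multiple of the identity
  plus the adjacency matrix of an edge colour \<open>u\<close> maps the indicator of \<open>w \<in> \<M>\<close> to a vector
  that counts, up to a term in \<open>L\<close>, the \<open>u\<close>-neighbours in \<open>w\<close>; its membership in \<open>L\<close> is
  equitability (\<open>finer_vertex_regular_if_invariant\<close>). As the same test matrices serve
  both models, the two equivalences hold with the same right-hand side.
\<close>

section \<open>Positive definite matrices\<close>

lemma pos_def_mat_1: "pos_def (mat 1 :: real^'v^'v)"
  by (simp add: pos_def_def)

lemma pos_def_invertible:
  fixes K :: "real^'v^'v"
  assumes "pos_def K"
  shows "invertible K"
proof -
  have "x = 0" if "K *v x = 0" for x
    using assms that unfolding pos_def_def by (metis inner_zero_right less_irrefl)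
  then show ?thesis
    by (metis invertible_left_inverse matrix_left_invertible_ker)
qed

text \<open>
  On the segment from the identity to \<open>K\<close> all matrices are positive definite, hence invertible,
  so the determinant cannot change sign. It makes the normalising factor of the likelihood
  positive, so that maximising the likelihood means minimising the quadratic form.
\<close>

lemma pos_def_det_pos:
  fixes K :: "real^'v^'v"
  assumes "pos_def K"
  shows "det K > 0"
proof (rule ccontr)
  assume "\<not> det K > 0"
  define H where "H t = (1 - t) *\<^sub>R mat 1 + t *\<^sub>R K" for t :: real
  have "continuous_on {0..1} (\<lambda>t. det (H t))"
    unfolding H_def det_def by (intro continuous_intros)
  moreover have "det (H 0) = 1" "det (H 1) \<le> 0"
    using \<open>\<not> det K > 0\<close> by (simp_all add: H_def)
  ultimately obtain t where t: "0 \<le> t" "t \<le> 1" "det (H t) = 0"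
    using IVT2'[of "\<lambda>t. det (H t)" 1 0 0] by auto
  have "pos_def (H t)"
    unfolding pos_def_def
  proof (intro allI impI)
    fix x :: "real^'v" assume "x \<noteq> 0"
    then have "x \<bullet> x > 0" "x \<bullet> (K *v x) > 0"
      using assms by (auto simp: pos_def_def)
    moreover have "x \<bullet> (H t *v x) = (1 - t) * (x \<bullet> x) + t * (x \<bullet> (K *v x))"
      by (simp add: H_def matrix_vector_mult_add_rdistrib scaleR_matrix_vector_assoc[symmetric] inner_add_right)
    ultimately show "x \<bullet> (H t *v x) > 0"
      using t(1,2) by (cases "t = 0") (auto intro!: add_nonneg_pos)
  qed
  then show False
    using t(3) pos_def_invertible invertible_det_nz by blast
qed

lemma symmetric_matrix_inner:
  fixes K :: "real^'v^'v"
  assumes "transpose K = K"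
  shows "x \<bullet> (K *v y) = (K *v x) \<bullet> y"
  by (metis assms dot_lmul_matrix transpose_matrix_vector)

section \<open>Normal equations\<close>

text \<open>
  Expanding around \<open>\<mu>\<close>, the cross term vanishes by the normal equation, and what remains is
  \<open>n\<close> times the quadratic form at \<open>\<mu> - \<nu>\<close>. The strict inequality gives optimality and
  uniqueness at once, for both estimators: \<open>K = mat 1\<close> is ordinary least squares.
\<close>

lemma quadratic_residuals_less:
  fixes K :: "real^'v^'v"
  assumes sym: "transpose K = K" and pd: "pos_def K" and n: "(n::nat) \<ge> 1"
    and S: "subspace S" "\<mu> \<in> S" "\<nu> \<in> S" and ne: "\<nu> \<noteq> \<mu>"
    and normal: "\<And>z. z \<in> S \<Longrightarrow> z \<bullet> (K *v (\<Sum>i<n. y i - \<mu>)) = 0"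
  shows "(\<Sum>i<n. (y i - \<mu>) \<bullet> (K *v (y i - \<mu>))) < (\<Sum>i<n. (y i - \<nu>) \<bullet> (K *v (y i - \<nu>)))"
proof -
  define d where "d = \<mu> - \<nu>"
  have dS: "d \<in> S" and d0: "d \<noteq> 0"
    using S ne by (auto simp: d_def subspace_diff)
  have "(y i - \<nu>) \<bullet> (K *v (y i - \<nu>)) =
      (y i - \<mu>) \<bullet> (K *v (y i - \<mu>)) + 2 * (d \<bullet> (K *v (y i - \<mu>))) + d \<bullet> (K *v d)" for i
  proof -
    have *: "y i - \<nu> = (y i - \<mu>) + d" by (simp add: d_def)
    have "(y i - \<mu>) \<bullet> (K *v d) = d \<bullet> (K *v (y i - \<mu>))"
      by (metis inner_commute symmetric_matrix_inner[OF sym])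
    then show ?thesis
      unfolding * matrix_vector_right_distrib inner_add_left inner_add_right by simp
  qed
  moreover have "(\<Sum>i<n. d \<bullet> (K *v (y i - \<mu>))) = d \<bullet> (K *v (\<Sum>i<n. y i - \<mu>))"
    by (simp add: matrix_vector_mul_linear linear_sum inner_sum_right)
  ultimately have "(\<Sum>i<n. (y i - \<nu>) \<bullet> (K *v (y i - \<nu>))) =
      (\<Sum>i<n. (y i - \<mu>) \<bullet> (K *v (y i - \<mu>))) + n * (d \<bullet> (K *v d))"
    using normal[OF dS] by (simp add: sum.distrib sum_distrib_left[symmetric])
  moreover have "n * (d \<bullet> (K *v d)) > 0"
    using pd d0 n by (simp add: pos_def_def)
  ultimately show ?thesis by simp
qed

lemma mean_spaceI:
  assumes "\<And>m \<alpha> \<beta>. m \<in> \<M> \<Longrightarrow> \<alpha> \<in> m \<Longrightarrow> \<beta> \<in> m \<Longrightarrow> x $ \<alpha> = x $ \<beta>"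
  shows "x \<in> mean_space \<M>"
  unfolding mean_space_def by (intro CollectI ballI) (rule assms)

lemma mean_spaceD:
  assumes "x \<in> mean_space \<M>" "m \<in> \<M>" "\<alpha> \<in> m" "\<beta> \<in> m"
  shows "x $ \<alpha> = x $ \<beta>"
  using assms unfolding mean_space_def mem_Collect_eq by meson

lemma subspace_mean_space: "subspace (mean_space \<M>)"
proof (rule subspaceI)
  show "0 \<in> mean_space \<M>" by (simp add: mean_space_def)
  fix x y :: "real^'a" and c :: real
  assume x: "x \<in> mean_space \<M>"
  show "c *\<^sub>R x \<in> mean_space \<M>"
  proof (rule mean_spaceI)
    fix m \<alpha> \<beta> assume "m \<in> \<M>" "\<alpha> \<in> m" "\<beta> \<in> m"
    from mean_spaceD[OF x this] show "(c *\<^sub>R x) $ \<alpha> = (c *\<^sub>R x) $ \<beta>" by simp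
  qed
  assume y: "y \<in> mean_space \<M>"
  show "x + y \<in> mean_space \<M>"
  proof (rule mean_spaceI)
    fix m \<alpha> \<beta> assume m: "m \<in> \<M>" "\<alpha> \<in> m" "\<beta> \<in> m"
    from mean_spaceD[OF x m] mean_spaceD[OF y m] show "(x + y) $ \<alpha> = (x + y) $ \<beta>" by simp
  qed
qed

lemma mle_eqI:
  fixes K :: "real^'v^'v"
  assumes "transpose K = K" "pos_def K" "n \<ge> 1" "\<mu> \<in> mean_space \<M>"
    and "\<And>z. z \<in> mean_space \<M> \<Longrightarrow> z \<bullet> (K *v (\<Sum>i<n. y i - \<mu>)) = 0"
  shows "mle \<M> n y K = \<mu>"
proof -
  have less: "likelihood n y K \<nu> < likelihood n y K \<mu>" if "\<nu> \<in> mean_space \<M>" "\<nu> \<noteq> \<mu>" for \<nu>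
    using quadratic_residuals_less[OF assms(1-3) subspace_mean_space assms(4) that assms(5)]
      pos_def_det_pos[OF assms(2)]
    by (simp add: likelihood_eq)
  show ?thesis
    unfolding mle_def arg_max_def
    by (rule some_equality) (use assms(4) less in \<open>force simp: is_arg_max_def\<close>)+
qed

lemma lse_eqI:
  assumes "n \<ge> 1" "\<mu> \<in> mean_space \<M>"
    and "\<And>z. z \<in> mean_space \<M> \<Longrightarrow> z \<bullet> (\<Sum>i<n. y i - \<mu>) = 0"
  shows "lse \<M> n y = \<mu>"
proof -
  have less: "(\<Sum>i<n. (norm (y i - \<mu>))\<^sup>2) < (\<Sum>i<n. (norm (y i - \<nu>))\<^sup>2)"
    if "\<nu> \<in> mean_space \<M>" "\<nu> \<noteq> \<mu>" for \<nu>
    using quadratic_residuals_less[OF _ pos_def_mat_1 assms(1) subspace_mean_space assms(2) that, of y] assms(3)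
    by (simp add: transpose_mat power2_norm_eq_inner)
  show ?thesis
    unfolding lse_def arg_min_def
    by (rule some_equality) (use assms(2) less in \<open>force simp: is_arg_min_def\<close>)+
qed

text \<open>
  The least-squares estimator is the orthogonal projection of the sample mean.
\<close>

lemma lse_normal_equation:
  assumes "n \<ge> 1"
  obtains "lse \<M> n y \<in> mean_space \<M>"
    "\<And>z. z \<in> mean_space \<M> \<Longrightarrow> z \<bullet> (\<Sum>i<n. y i - lse \<M> n y) = 0"
proof -
  let ?a = "(1 / n) *\<^sub>R (\<Sum>i<n. y i)"
  obtain p q where pq: "p \<in> span (mean_space \<M>)" "\<And>w. w \<in> span (mean_space \<M>) \<Longrightarrow> orthogonal q w"
    "?a = p + q"
    using orthogonal_subspace_decomp_exists[of "mean_space \<M>" ?a] by metis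
  have p: "p \<in> mean_space \<M>"
    using pq(1) subspace_mean_space span_eq_iff by blast
  have "(\<Sum>i<n. y i - p) = real n *\<^sub>R (?a - p)"
    using assms by (simp add: sum_subtractf scaleR_right_diff_distrib sum_constant_scaleR del: sum_constant)
  then have "(\<Sum>i<n. y i - p) = real n *\<^sub>R q"
    using pq(3) by simp
  then have z: "z \<bullet> (\<Sum>i<n. y i - p) = 0" if "z \<in> mean_space \<M>" for z
    using pq(2)[of z] that by (simp add: span_base orthogonal_def inner_commute)
  then have "lse \<M> n y = p"
    using lse_eqI[OF assms p] by blast
  then show thesis using that p z by simp
qed

text \<open>
  If \<open>K\<close> preserves the mean space, the least-squares estimator solves the weighted normal equation.
  For the converse, take constant samples \<open>x\<close> with \<open>K x\<close> orthogonal to the mean space: their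
  maximum likelihood estimator is \<open>0\<close>, so the least-squares estimator is \<open>0\<close> and \<open>x\<close> itself is
  orthogonal. Thus the preimage of the orthogonal complement under \<open>K\<close> is contained in the
  complement; since \<open>K\<close> is invertible, the dimensions agree and \<open>K\<close> preserves the complement,
  hence by symmetry the mean space.
\<close>

theorem mle_eq_lse_iff_invariant:
  fixes K :: "real^'v^'v"
  assumes sym: "transpose K = K" and pd: "pos_def K" and n: "n \<ge> 1"
  shows "(\<forall>y. mle \<M> n y K = lse \<M> n y) \<longleftrightarrow> (\<forall>x\<in>mean_space \<M>. K *v x \<in> mean_space \<M>)"
proof
  assume inv: "\<forall>x\<in>mean_space \<M>. K *v x \<in> mean_space \<M>"
  show "\<forall>y. mle \<M> n y K = lse \<M> n y"
  proof
    fix y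
    obtain l: "lse \<M> n y \<in> mean_space \<M>"
      "\<And>z. z \<in> mean_space \<M> \<Longrightarrow> z \<bullet> (\<Sum>i<n. y i - lse \<M> n y) = 0"
      using lse_normal_equation[OF n] by metis
    show "mle \<M> n y K = lse \<M> n y"
      by (rule mle_eqI[OF sym pd n l(1)]) (simp add: symmetric_matrix_inner[OF sym] l(2) inv)
  qed
next
  assume eq: "\<forall>y. mle \<M> n y K = lse \<M> n y"
  let ?L = "mean_space \<M>"
  let ?P = "orthogonal_comp ?L"
  define N where "N = {x. K *v x \<in> ?P}"
  have N: "subspace N"
    unfolding N_def
    by (rule linear_subspace_vimage[unfolded vimage_def, OF matrix_vector_mul_linear subspace_orthogonal_comp])
  have "N \<subseteq> ?P"
  proof
    fix x assume x: "x \<in> N"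
    have "K *v (\<Sum>i<n. x - 0) = real n *\<^sub>R (K *v x)"
      by (simp add: sum_constant_scaleR matrix_vector_mult_scaleR del: sum_constant)
    then have "mle \<M> n (\<lambda>_. x) K = 0"
      using x by (intro mle_eqI[OF sym pd n])
        (auto simp: N_def orthogonal_comp_def orthogonal_def subspace_0[OF subspace_mean_space])
    then have "lse \<M> n (\<lambda>_. x) = 0" using eq by metis
    then show "x \<in> ?P"
      using lse_normal_equation[OF n, of \<M> "\<lambda>_. x"] n
      by (auto simp: orthogonal_comp_def orthogonal_def sum_constant_scaleR simp del: sum_constant)
  qed
  moreover have "dim ?P \<le> dim N"
  proof -
    have "surj ((*v) K)"
      using pos_def_invertible[OF pd] invertible_right_inverse matrix_right_invertible_surjective by blast
    then have "?P = (*v) K ` N" unfolding N_def by (auto simp: surj_def)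
    then show ?thesis using dim_image_le[OF matrix_vector_mul_linear] by metis
  qed
  ultimately have NP: "N = ?P"
    using subspace_dim_equal[OF N subspace_orthogonal_comp] by blast
  show "\<forall>x\<in>?L. K *v x \<in> ?L"
  proof
    fix x assume x: "x \<in> ?L"
    have "p \<bullet> (K *v x) = 0" if "p \<in> ?P" for p
    proof -
      have "K *v p \<in> ?P" using that NP N_def by blast
      then have "(K *v p) \<bullet> x = 0"
        using x by (auto simp: orthogonal_comp_def orthogonal_def inner_commute)
      then show ?thesis by (simp add: symmetric_matrix_inner[OF sym])
    qed
    then have "K *v x \<in> orthogonal_comp ?P"
      unfolding orthogonal_comp_def[of ?P] orthogonal_def by blast
    then show "K *v x \<in> ?L"
      by (simp add: orthogonal_comp_self subspace_mean_space)
  qed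
qed

section \<open>Vertex regularity preserves the mean space\<close>

text \<open>
  A vector of the mean space is constant on each \<open>w \<in> \<M>\<close>, so a sum over neighbours only depends
  on how many of them lie in each \<open>w\<close>.
\<close>

lemma equitable_sum_neighbours:
  fixes z :: "real^'v"
  assumes M: "partition_on UNIV \<M>" and eq: "equitable \<M> A" and z: "z \<in> mean_space \<M>"
    and m: "m \<in> \<M>" "\<alpha> \<in> m" "\<beta> \<in> m"
  shows "(\<Sum>\<gamma>\<in>ne A \<alpha>. z $ \<gamma>) = (\<Sum>\<gamma>\<in>ne A \<beta>. z $ \<gamma>)"
proof -
  have *: "(\<Sum>\<gamma>\<in>ne A \<delta>. z $ \<gamma>) = (\<Sum>w\<in>\<M>. real (card (ne A \<delta> \<inter> w)) * z $ (SOME \<gamma>. \<gamma> \<in> w))" for \<delta>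
  proof -
    have "(\<Sum>\<gamma>\<in>ne A \<delta>. z $ \<gamma>) = (\<Sum>\<gamma>\<in>(\<Union>w\<in>\<M>. ne A \<delta> \<inter> w). z $ \<gamma>)"
      using M by (intro sum.cong) (auto simp: partition_on_def)
    also have "\<dots> = (\<Sum>w\<in>\<M>. \<Sum>\<gamma>\<in>ne A \<delta> \<inter> w. z $ \<gamma>)"
      using M by (intro sum.UNION_disjoint) (auto simp: partition_on_def disjoint_def)
    also have "\<dots> = (\<Sum>w\<in>\<M>. \<Sum>\<gamma>\<in>ne A \<delta> \<inter> w. z $ (SOME \<gamma>. \<gamma> \<in> w))"
    proof (intro sum.cong refl)
      fix w \<gamma> assume "w \<in> \<M>" "\<gamma> \<in> ne A \<delta> \<inter> w"
      then show "z $ \<gamma> = z $ (SOME \<gamma>. \<gamma> \<in> w)"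
        using z someI[of "\<lambda>\<gamma>. \<gamma> \<in> w" \<gamma>] unfolding mean_space_def by blast
    qed
    finally show ?thesis by simp
  qed
  have "card (ne A \<alpha> \<inter> w) = card (ne A \<beta> \<inter> w)" if "w \<in> \<M>" for w
    using eq m that unfolding equitable_def by blast
  then show ?thesis unfolding * by simp
qed

text \<open>
  The factors \<open>a u\<close> and \<open>s\<close> allow one argument for both models; \<open>s\<close> can be absorbed into \<open>x\<close>
  because the mean space is closed under componentwise products.
\<close>

lemma invariant_if_vertex_regular:
  fixes K :: "real^'v^'v"
  assumes E: "simple_graph E" "partition_on E \<E>" and M: "partition_on UNIV \<M>"
    and reg: "vertex_regular \<M> \<E>"
    and K0: "\<And>\<alpha> \<beta>. \<alpha> \<noteq> \<beta> \<Longrightarrow> {\<alpha>, \<beta>} \<notin> E \<Longrightarrow> K $ \<alpha> $ \<beta> = 0"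
    and diag: "(\<chi> \<alpha>. K $ \<alpha> $ \<alpha>) \<in> mean_space \<M>"
    and s: "s \<in> mean_space \<M>"
    and off: "\<And>u \<alpha> \<beta>. u \<in> \<E> \<Longrightarrow> {\<alpha>, \<beta>} \<in> u \<Longrightarrow> K $ \<alpha> $ \<beta> = a u * s $ \<alpha> * s $ \<beta>"
    and x: "x \<in> mean_space \<M>"
  shows "K *v x \<in> mean_space \<M>"
proof -
  define z where "z = (\<chi> \<gamma>. s $ \<gamma> * x $ \<gamma>)"
  have z: "z \<in> mean_space \<M>"
  proof (rule mean_spaceI)
    fix m \<alpha> \<beta> assume "m \<in> \<M>" "\<alpha> \<in> m" "\<beta> \<in> m"
    then have "s $ \<alpha> = s $ \<beta>" "x $ \<alpha> = x $ \<beta>"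
      using s x mean_spaceD by blast+
    then show "z $ \<alpha> = z $ \<beta>" by (simp add: z_def)
  qed
  have edge: "\<alpha> \<noteq> \<beta>" if "{\<alpha>, \<beta>} \<in> E" for \<alpha> \<beta>
    using E(1) that unfolding simple_graph_def by force
  have row: "(K *v x) $ \<alpha> = K $ \<alpha> $ \<alpha> * x $ \<alpha> + (\<Sum>u\<in>\<E>. a u * s $ \<alpha> * (\<Sum>\<gamma>\<in>ne u \<alpha>. z $ \<gamma>))" for \<alpha>
  proof -
    have "(K *v x) $ \<alpha> = K $ \<alpha> $ \<alpha> * x $ \<alpha> + (\<Sum>\<gamma>\<in>UNIV - {\<alpha>}. K $ \<alpha> $ \<gamma> * x $ \<gamma>)"
      by (simp add: matrix_vector_mult_def sum.remove)
    also have "(\<Sum>\<gamma>\<in>UNIV - {\<alpha>}. K $ \<alpha> $ \<gamma> * x $ \<gamma>) = (\<Sum>\<gamma>\<in>ne E \<alpha>. K $ \<alpha> $ \<gamma> * x $ \<gamma>)"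
      by (intro sum.mono_neutral_right) (use K0 edge in \<open>auto simp: ne_def\<close>)
    also have "ne E \<alpha> = (\<Union>u\<in>\<E>. ne u \<alpha>)"
      using E(2) by (auto simp: ne_def partition_on_def)
    also have "(\<Sum>\<gamma>\<in>(\<Union>u\<in>\<E>. ne u \<alpha>). K $ \<alpha> $ \<gamma> * x $ \<gamma>) = (\<Sum>u\<in>\<E>. \<Sum>\<gamma>\<in>ne u \<alpha>. K $ \<alpha> $ \<gamma> * x $ \<gamma>)"
      using E(2) by (intro sum.UNION_disjoint) (auto simp: ne_def partition_on_def disjoint_def)
    also have "\<dots> = (\<Sum>u\<in>\<E>. a u * s $ \<alpha> * (\<Sum>\<gamma>\<in>ne u \<alpha>. z $ \<gamma>))"
      unfolding sum_distrib_left
      by (intro sum.cong refl) (simp add: off ne_def z_def)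
    finally show ?thesis .
  qed
  show ?thesis
  proof (rule mean_spaceI)
    fix m \<alpha> \<beta> assume m: "m \<in> \<M>" "\<alpha> \<in> m" "\<beta> \<in> m"
    have "K $ \<alpha> $ \<alpha> = K $ \<beta> $ \<beta>" "x $ \<alpha> = x $ \<beta>" "s $ \<alpha> = s $ \<beta>"
      using mean_spaceD[OF diag m] mean_spaceD[OF x m] mean_spaceD[OF s m] by simp_all
    moreover have "(\<Sum>\<gamma>\<in>ne u \<alpha>. z $ \<gamma>) = (\<Sum>\<gamma>\<in>ne u \<beta>. z $ \<gamma>)" if "u \<in> \<E>" for u
      using equitable_sum_neighbours[OF M _ z m] reg that unfolding vertex_regular_def by blast
    ultimately show "(K *v x) $ \<alpha> = (K *v x) $ \<beta>"
      unfolding row by simp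
  qed
qed

lemma finer_class_constant:
  assumes M: "partition_on UNIV \<M>" and V: "partition_on UNIV \<V>" and fin: "finer \<M> \<V>"
    and c: "\<forall>v\<in>\<V>. \<forall>\<alpha>\<in>v. \<forall>\<beta>\<in>v. f \<alpha> = f \<beta>"
  shows "(\<chi> \<alpha>. f \<alpha>) \<in> mean_space \<M>"
proof -
  have "\<exists>v\<in>\<V>. m \<subseteq> v" if "m \<in> \<M>" for m
    using fin finer_iff_refines[OF M V] that unfolding refines_def by blast
  then show ?thesis using c unfolding mean_space_def by simp blast
qed

lemma S_plus_invariant:
  assumes G: "colored_graph E \<V> \<E>" and M: "partition_on UNIV \<M>"
    and fin: "finer \<M> \<V>" and reg: "vertex_regular \<M> \<E>"
    and K: "K \<in> S_plus E \<V> \<E>" and x: "x \<in> mean_space \<M>"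
  shows "K *v x \<in> mean_space \<M>"
proof -
  have E: "simple_graph E" "partition_on E \<E>" and V: "partition_on UNIV \<V>"
    using G by (auto simp: colored_graph_def)
  have const: "\<forall>v\<in>\<V>. \<forall>\<alpha>\<in>v. \<forall>\<beta>\<in>v. K $ \<alpha> $ \<alpha> = K $ \<beta> $ \<beta>"
    and edges: "\<And>u \<alpha> \<beta> \<gamma> \<delta>. u \<in> \<E> \<Longrightarrow> {\<alpha>, \<beta>} \<in> u \<Longrightarrow> {\<gamma>, \<delta>} \<in> u \<Longrightarrow> K $ \<alpha> $ \<beta> = K $ \<gamma> $ \<delta>"
    and zero: "\<And>\<alpha> \<beta>. \<alpha> \<noteq> \<beta> \<Longrightarrow> {\<alpha>, \<beta>} \<notin> E \<Longrightarrow> K $ \<alpha> $ \<beta> = 0"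
    using K unfolding S_plus_def S_plus_graph_def mem_Collect_eq by meson+
  have "\<exists>a. \<forall>\<alpha> \<beta>. {\<alpha>, \<beta>} \<in> u \<longrightarrow> K $ \<alpha> $ \<beta> = a" if "u \<in> \<E>" for u
    using edges[OF that] by metis
  then obtain a where a: "\<And>u \<alpha> \<beta>. u \<in> \<E> \<Longrightarrow> {\<alpha>, \<beta>} \<in> u \<Longrightarrow> K $ \<alpha> $ \<beta> = a u"
    by metis
  have one: "(\<chi> \<alpha>. 1) \<in> mean_space \<M>" by (simp add: mean_space_def)
  show ?thesis
    by (rule invariant_if_vertex_regular[OF E M reg zero finer_class_constant[OF M V fin const] one _ x, of a])
      (simp_all add: a)
qed

lemma R_plus_invariant:
  assumes G: "colored_graph E \<V> \<E>" and M: "partition_on UNIV \<M>"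
    and fin: "finer \<M> \<V>" and reg: "vertex_regular \<M> \<E>"
    and K: "K \<in> R_plus E \<V> \<E>" and x: "x \<in> mean_space \<M>"
  shows "K *v x \<in> mean_space \<M>"
proof -
  have E: "simple_graph E" "partition_on E \<E>" and V: "partition_on UNIV \<V>"
    using G by (auto simp: colored_graph_def)
  have const: "\<forall>v\<in>\<V>. \<forall>\<alpha>\<in>v. \<forall>\<beta>\<in>v. K $ \<alpha> $ \<alpha> = K $ \<beta> $ \<beta>"
    and edges: "\<And>u \<alpha> \<beta> \<gamma> \<delta>. u \<in> \<E> \<Longrightarrow> {\<alpha>, \<beta>} \<in> u \<Longrightarrow> {\<gamma>, \<delta>} \<in> u \<Longrightarrow>
        partial_corr K \<alpha> \<beta> = partial_corr K \<gamma> \<delta>"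
    and zero: "\<And>\<alpha> \<beta>. \<alpha> \<noteq> \<beta> \<Longrightarrow> {\<alpha>, \<beta>} \<notin> E \<Longrightarrow> K $ \<alpha> $ \<beta> = 0"
    and pd: "pos_def K"
    using K unfolding R_plus_def S_plus_graph_def mem_Collect_eq by meson+
  have pos: "K $ \<alpha> $ \<alpha> > 0" for \<alpha>
  proof -
    have "axis \<alpha> 1 \<bullet> (K *v axis \<alpha> 1) > 0"
      using pd by (simp add: pos_def_def axis_eq_0_iff)
    then show ?thesis
      by (simp add: inner_axis' matrix_vector_mul_component inner_axis)
  qed
  have "\<exists>r. \<forall>\<alpha> \<beta>. {\<alpha>, \<beta>} \<in> u \<longrightarrow> partial_corr K \<alpha> \<beta> = r" if "u \<in> \<E>" for u
    using edges[OF that] by metis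
  then obtain r where r: "\<And>u \<alpha> \<beta>. u \<in> \<E> \<Longrightarrow> {\<alpha>, \<beta>} \<in> u \<Longrightarrow> partial_corr K \<alpha> \<beta> = r u"
    by metis
  have entry: "K $ \<alpha> $ \<beta> = - partial_corr K \<alpha> \<beta> * sqrt (K $ \<alpha> $ \<alpha>) * sqrt (K $ \<beta> $ \<beta>)" for \<alpha> \<beta>
    using pos[of \<alpha>] pos[of \<beta>] by (simp add: partial_corr_def real_sqrt_mult)
  have off: "K $ \<alpha> $ \<beta> = - r u * (\<chi> \<alpha>. sqrt (K $ \<alpha> $ \<alpha>)) $ \<alpha> * (\<chi> \<alpha>. sqrt (K $ \<alpha> $ \<alpha>)) $ \<beta>"
    if "u \<in> \<E>" "{\<alpha>, \<beta>} \<in> u" for u \<alpha> \<beta>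
    using entry[of \<alpha> \<beta>] r[OF that] by (simp only: vec_lambda_beta)
  have "\<forall>v\<in>\<V>. \<forall>\<alpha>\<in>v. \<forall>\<beta>\<in>v. sqrt (K $ \<alpha> $ \<alpha>) = sqrt (K $ \<beta> $ \<beta>)"
    by (intro ballI arg_cong[of _ _ sqrt]) (use const in meson)
  note s = finer_class_constant[OF M V fin this]
  show ?thesis
    by (rule invariant_if_vertex_regular[OF E M reg zero finer_class_constant[OF M V fin const] s _ x, of "\<lambda>u. - r u"])
      (assumption | erule (1) off)+
qed

section \<open>Necessity, by test matrices common to both models\<close>

text \<open>
  The matrices used for necessity are constructed once for both models.
\<close>

lemma S_plus_R_plusI:
  assumes "transpose K = K" "pos_def K"
    and "\<And>\<alpha> \<beta>. \<alpha> \<noteq> \<beta> \<Longrightarrow> {\<alpha>, \<beta>} \<notin> E \<Longrightarrow> K $ \<alpha> $ \<beta> = 0"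
    and "\<And>v \<alpha> \<beta>. v \<in> \<V> \<Longrightarrow> \<alpha> \<in> v \<Longrightarrow> \<beta> \<in> v \<Longrightarrow> K $ \<alpha> $ \<alpha> = K $ \<beta> $ \<beta>"
    and "\<And>u \<alpha> \<beta> \<gamma> \<delta>. u \<in> \<E> \<Longrightarrow> {\<alpha>, \<beta>} \<in> u \<Longrightarrow> {\<gamma>, \<delta>} \<in> u \<Longrightarrow> K $ \<alpha> $ \<beta> = K $ \<gamma> $ \<delta>"
    and "\<And>u \<alpha> \<beta> \<gamma> \<delta>. u \<in> \<E> \<Longrightarrow> {\<alpha>, \<beta>} \<in> u \<Longrightarrow> {\<gamma>, \<delta>} \<in> u \<Longrightarrow>
      partial_corr K \<alpha> \<beta> = partial_corr K \<gamma> \<delta>"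
  shows "K \<in> S_plus E \<V> \<E> \<inter> R_plus E \<V> \<E>"
  unfolding S_plus_def R_plus_def S_plus_graph_def
  by (intro IntI CollectI conjI ballI allI impI; (elim conjE)?; (rule assms; assumption))

lemma diag_in_S_plus_R_plus:
  fixes d :: "'v::finite \<Rightarrow> real"
  assumes G: "colored_graph E \<V> \<E>" and pos: "\<And>\<alpha>. d \<alpha> > 0"
    and d: "\<And>v \<alpha> \<beta>. v \<in> \<V> \<Longrightarrow> \<alpha> \<in> v \<Longrightarrow> \<beta> \<in> v \<Longrightarrow> d \<alpha> = d \<beta>"
  shows "(\<chi> \<alpha> \<beta>. if \<alpha> = \<beta> then d \<alpha> else 0) \<in> S_plus E \<V> \<E> \<inter> R_plus E \<V> \<E>"
    (is "?K \<in> _")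
proof -
  have edge: "\<alpha> \<noteq> \<beta>" if "u \<in> \<E>" "{\<alpha>, \<beta>} \<in> u" for u \<alpha> \<beta>
    using G that unfolding colored_graph_def simple_graph_def partition_on_def by force
  have "pos_def ?K"
    unfolding pos_def_def
  proof (intro allI impI)
    fix x :: "real^'v" assume "x \<noteq> 0"
    then obtain \<alpha> where "x $ \<alpha> \<noteq> 0" by (auto simp: vec_eq_iff)
    then have "(\<Sum>\<alpha>\<in>UNIV. d \<alpha> * (x $ \<alpha>)\<^sup>2) > 0"
      using pos by (intro sum_pos2[of _ \<alpha>]) (auto simp: less_imp_le)
    moreover have "(?K *v x) $ \<alpha> = d \<alpha> * x $ \<alpha>" for \<alpha>
      by (simp add: matrix_vector_mult_def if_distrib[of "\<lambda>t. t * _"] cong: if_cong)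
    ultimately show "x \<bullet> (?K *v x) > 0"
      by (simp add: inner_vec_def power2_eq_square mult_ac)
  qed
  moreover have "transpose ?K = ?K"
    by (auto simp: transpose_def vec_eq_iff)
  moreover have off: "?K $ \<alpha> $ \<beta> = 0" "partial_corr ?K \<alpha> \<beta> = 0" if "\<alpha> \<noteq> \<beta>" for \<alpha> \<beta>
    using that by (simp_all add: partial_corr_def)
  moreover have "?K $ \<alpha> $ \<alpha> = ?K $ \<beta> $ \<beta>" if "v \<in> \<V>" "\<alpha> \<in> v" "\<beta> \<in> v" for v \<alpha> \<beta>
    using d[OF that] by simp
  ultimately show ?thesis
    by (intro S_plus_R_plusI) (assumption | simp only: off edge not_False_eq_True)+
qed

text \<open>
  The diagonal is constant, so equal concentrations and equal partial correlations are the same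
  condition. The factor \<open>CARD('v) + 1\<close> makes the matrix strictly diagonally dominant.
\<close>

lemma adjacency_in_S_plus_R_plus:
  fixes E :: "'v::finite set set"
  assumes G: "colored_graph E \<V> \<E>" and u: "u \<in> \<E>"
  shows "(\<chi> \<alpha> \<beta>. (if \<alpha> = \<beta> then real CARD('v) + 1 else 0) + of_bool ({\<alpha>, \<beta>} \<in> u))
    \<in> S_plus E \<V> \<E> \<inter> R_plus E \<V> \<E>" (is "?K \<in> _")
proof -
  define A :: "'v \<Rightarrow> 'v \<Rightarrow> real" where "A \<alpha> \<beta> = of_bool ({\<alpha>, \<beta>} \<in> u)" for \<alpha> \<beta>
  have edge: "\<alpha> \<noteq> \<beta>" if "u \<in> \<E>" "{\<alpha>, \<beta>} \<in> u" for u \<alpha> \<beta>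
    using G that unfolding colored_graph_def simple_graph_def partition_on_def by force
  have uE: "u \<subseteq> E"
    using G u unfolding colored_graph_def partition_on_def by blast
  have same: "{\<alpha>, \<beta>} \<in> u \<longleftrightarrow> {\<gamma>, \<delta>} \<in> u" if "u' \<in> \<E>" "{\<alpha>, \<beta>} \<in> u'" "{\<gamma>, \<delta>} \<in> u'" for u' \<alpha> \<beta> \<gamma> \<delta>
    using G u that unfolding colored_graph_def partition_on_def disjoint_def by blast
  have "pos_def ?K"
    unfolding pos_def_def
  proof (intro allI impI)
    fix x :: "real^'v" assume x: "x \<noteq> 0"
    have "(?K *v x) $ \<alpha> = (real CARD('v) + 1) * x $ \<alpha> + (\<Sum>\<beta>\<in>UNIV. A \<alpha> \<beta> * x $ \<beta>)" for \<alpha>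
      by (simp add: matrix_vector_mult_def A_def distrib_right sum.distrib if_distrib[of "\<lambda>t. t * _"] cong: if_cong)
    then have eq: "x \<bullet> (?K *v x) = (real CARD('v) + 1) * (x \<bullet> x) + (\<Sum>\<alpha>\<in>UNIV. \<Sum>\<beta>\<in>UNIV. x $ \<alpha> * (A \<alpha> \<beta> * x $ \<beta>))"
      unfolding inner_vec_def by (simp add: distrib_left sum.distrib sum_distrib_left mult_ac)
    \<comment> \<open>The entries of \<open>A\<close> lie in \<open>{0, 1}\<close>, so its quadratic form is at least \<open>- CARD('v)\<close> times the squared norm.\<close>
    have "- (x $ \<alpha> * (A \<alpha> \<beta> * x $ \<beta>)) \<le> ((x $ \<alpha>)\<^sup>2 + (x $ \<beta>)\<^sup>2) / 2" for \<alpha> \<beta>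
      using zero_le_power2[of "x $ \<alpha> + x $ \<beta>"]
      by (auto simp: A_def power2_sum field_simps)
    then have "(\<Sum>\<alpha>\<in>UNIV. \<Sum>\<beta>\<in>UNIV. - (x $ \<alpha> * (A \<alpha> \<beta> * x $ \<beta>)))
        \<le> (\<Sum>\<alpha>\<in>(UNIV::'v set). \<Sum>\<beta>\<in>(UNIV::'v set). ((x $ \<alpha>)\<^sup>2 + (x $ \<beta>)\<^sup>2) / 2)"
      by (intro sum_mono)
    also have "\<dots> = real CARD('v) * (x \<bullet> x)"
      by (simp add: add_divide_distrib sum.distrib inner_vec_def power2_eq_square sum_divide_distrib[symmetric] sum_distrib_left[symmetric])
    finally have "x \<bullet> (?K *v x) \<ge> x \<bullet> x"
      unfolding eq by (simp add: sum_negf algebra_simps)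
    moreover have "x \<bullet> x > 0" using x by simp
    ultimately show "x \<bullet> (?K *v x) > 0" by linarith
  qed
  moreover have "transpose ?K = ?K"
    by (auto simp: transpose_def vec_eq_iff insert_commute)
  moreover have "?K $ \<alpha> $ \<beta> = 0" if "\<alpha> \<noteq> \<beta>" "{\<alpha>, \<beta>} \<notin> E" for \<alpha> \<beta>
    using that uE by auto
  moreover have diag: "?K $ \<alpha> $ \<alpha> = real CARD('v) + 1" for \<alpha>
    using edge[OF u, of \<alpha> \<alpha>] by auto
  moreover have off: "?K $ \<alpha> $ \<beta> = ?K $ \<gamma> $ \<delta>" if "u' \<in> \<E>" "{\<alpha>, \<beta>} \<in> u'" "{\<gamma>, \<delta>} \<in> u'" for u' \<alpha> \<beta> \<gamma> \<delta>
    using same[OF that] edge[OF that(1,2)] edge[OF that(1,3)] by simp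
  moreover have "partial_corr ?K \<alpha> \<beta> = partial_corr ?K \<gamma> \<delta>"
    if "u' \<in> \<E>" "{\<alpha>, \<beta>} \<in> u'" "{\<gamma>, \<delta>} \<in> u'" for u' \<alpha> \<beta> \<gamma> \<delta>
    by (simp only: partial_corr_def diag off[OF that])
  ultimately show ?thesis
    by (intro S_plus_R_plusI) (assumption | simp only: diag)+
qed

text \<open>
  Invariance is assumed only for matrices common to both models, so that the conclusion follows
  from either of them. The first part tests the all-one vector, the second the indicators of the
  classes, which span the mean space.
\<close>

lemma finer_vertex_regular_if_invariant:
  fixes E :: "'v::finite set set"
  assumes G: "colored_graph E \<V> \<E>" and M: "partition_on UNIV \<M>"
    and inv: "\<And>K x. K \<in> S_plus E \<V> \<E> \<inter> R_plus E \<V> \<E> \<Longrightarrow> x \<in> mean_space \<M> \<Longrightarrow> K *v x \<in> mean_space \<M>"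
  shows "finer \<M> \<V> \<and> vertex_regular \<M> \<E>"
proof
  have V: "partition_on UNIV \<V>"
    using G by (simp add: colored_graph_def)
  have "\<exists>v\<in>\<V>. m \<subseteq> v" if m: "m \<in> \<M>" for m
  proof -
    obtain \<alpha> where \<alpha>: "\<alpha> \<in> m" using M m by (force simp: partition_on_def)
    obtain v where v: "v \<in> \<V>" "\<alpha> \<in> v" using V unfolding partition_on_def by blast
    define d :: "'v \<Rightarrow> real" where "d \<beta> = 1 + of_bool (\<beta> \<in> v)" for \<beta>
    let ?K = "\<chi> \<alpha> \<beta>. if \<alpha> = \<beta> then d \<alpha> else 0"
    have "?K \<in> S_plus E \<V> \<E> \<inter> R_plus E \<V> \<E>"
    proof (rule diag_in_S_plus_R_plus[OF G])
      show "d \<alpha> = d \<beta>" if "v' \<in> \<V>" "\<alpha> \<in> v'" "\<beta> \<in> v'" for v' \<alpha> \<beta>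
        using V v that by (auto simp: partition_on_def disjoint_def d_def)
    qed (simp add: d_def add_pos_nonneg)
    moreover have "(\<chi> \<alpha>. 1) \<in> mean_space \<M>" by (simp add: mean_space_def)
    ultimately have "?K *v (\<chi> \<alpha>. 1) \<in> mean_space \<M>" using inv by blast
    moreover have "?K *v (\<chi> \<alpha>. 1) = (\<chi> \<alpha>. d \<alpha>)"
      by (simp add: matrix_vector_mult_def vec_eq_iff)
    ultimately have d: "(\<chi> \<alpha>. d \<alpha>) \<in> mean_space \<M>" by simp
    have "d \<alpha> = d \<beta>" if "\<beta> \<in> m" for \<beta>
      using mean_spaceD[OF d m \<alpha> that] by simp
    then have "m \<subseteq> v" using v by (auto simp: d_def split: if_splits)
    then show ?thesis using v by blast
  qed
  then show "finer \<M> \<V>"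
    unfolding finer_iff_refines[OF M V] refines_def using M V by blast
next
  show "vertex_regular \<M> \<E>"
    unfolding vertex_regular_def equitable_def
  proof (intro ballI)
    fix u m \<alpha> \<beta> w
    assume u: "u \<in> \<E>" and m: "m \<in> \<M>" "\<alpha> \<in> m" "\<beta> \<in> m" and w: "w \<in> \<M>"
    let ?K = "\<chi> \<alpha> \<beta>. (if \<alpha> = \<beta> then real CARD('v) + 1 else 0) + of_bool ({\<alpha>, \<beta>} \<in> u) :: real^'v^'v"
    let ?x = "\<chi> \<gamma>. of_bool (\<gamma> \<in> w) :: real^'v"
    have x: "?x \<in> mean_space \<M>"
      using M w by (auto simp: mean_space_def partition_on_def disjoint_def)
    have "?K *v ?x \<in> mean_space \<M>"
      using inv[OF adjacency_in_S_plus_R_plus[OF G u] x] .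
    then have "(?K *v ?x) $ \<alpha> = (?K *v ?x) $ \<beta>"
      using mean_spaceD m by blast
    moreover have "(?K *v ?x) $ \<delta> = (real CARD('v) + 1) * ?x $ \<delta> + real (card (ne u \<delta> \<inter> w))" for \<delta>
    proof -
      have "(\<Sum>\<gamma>\<in>UNIV. of_bool ({\<delta>, \<gamma>} \<in> u) * of_bool (\<gamma> \<in> w)) = real (card (ne u \<delta> \<inter> w))"
        by (simp add: ne_def of_bool_conj[symmetric] Int_def)
      then show ?thesis
        by (simp add: matrix_vector_mult_def distrib_right sum.distrib if_distrib[of "\<lambda>t. t * _"] cong: if_cong)
    qed
    moreover have "?x $ \<alpha> = ?x $ \<beta>"
      using mean_spaceD x m by blast
    ultimately show "card (ne u \<alpha> \<inter> w) = card (ne u \<beta> \<inter> w)" by simp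
  qed
qed

section \<open>Equality of the estimators\<close>

theorem theorem2:
  fixes E :: "('v::finite) set set"
    and \<V> :: "'v set set"
    and \<E> :: "'v set set set"
    and \<M> :: "'v set set"
    and n :: nat
  assumes "colored_graph E \<V> \<E>"
    and "partition_on UNIV \<M>"
    and "n \<ge> 1"
  shows "((\<forall>K \<in> S_plus E \<V> \<E>. \<forall>y :: nat \<Rightarrow> real^'v. mle \<M> n y K = lse \<M> n y)
            \<longleftrightarrow> finer \<M> \<V> \<and> vertex_regular \<M> \<E>) \<and>
         ((\<forall>K \<in> R_plus E \<V> \<E>. \<forall>y :: nat \<Rightarrow> real^'v. mle \<M> n y K = lse \<M> n y)
            \<longleftrightarrow> finer \<M> \<V> \<and> vertex_regular \<M> \<E>)"
proof -
  have iff: "(\<forall>y. mle \<M> n y K = lse \<M> n y) \<longleftrightarrow> (\<forall>x\<in>mean_space \<M>. K *v x \<in> mean_space \<M>)"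
    if "K \<in> S_plus_graph E" for K
    by (rule mle_eq_lse_iff_invariant) (use that assms(3) in \<open>simp_all add: S_plus_graph_def\<close>)
  have sub: "S_plus E \<V> \<E> \<subseteq> S_plus_graph E" "R_plus E \<V> \<E> \<subseteq> S_plus_graph E"
    unfolding S_plus_def R_plus_def by (rule Collect_restrict)+
  have necessary: "finer \<M> \<V> \<and> vertex_regular \<M> \<E>"
    if "S_plus E \<V> \<E> \<inter> R_plus E \<V> \<E> \<subseteq> T" "T \<subseteq> S_plus_graph E"
      "\<forall>K\<in>T. \<forall>y. mle \<M> n y K = lse \<M> n y" for T
    using finer_vertex_regular_if_invariant[OF assms(1,2)] iff that by blast
  show ?thesis
  proof (intro conjI iffI)
    show "\<forall>K\<in>S_plus E \<V> \<E>. \<forall>y. mle \<M> n y K = lse \<M> n y"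
      if "finer \<M> \<V> \<and> vertex_regular \<M> \<E>"
      using iff sub S_plus_invariant[OF assms(1,2)] that by blast
    show "\<forall>K\<in>R_plus E \<V> \<E>. \<forall>y. mle \<M> n y K = lse \<M> n y"
      if "finer \<M> \<V> \<and> vertex_regular \<M> \<E>"
      using iff sub R_plus_invariant[OF assms(1,2)] that by blast
  qed (use necessary[OF Int_lower1 sub(1)] necessary[OF Int_lower2 sub(2)] in blast)+
qed

end
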